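(* The bicomplex exponential function $\exp:\mathrm{B}\to\mathrm{B}$, defined by $e^{p}=(e^{a}\cos b,\ e^{a}\sin b)$ for $p=(a,b)\in\mathrm{B}$, takes every nonsingular value and no singular value; that is, for $q\in\mathrm{B}$ there exists $p\in\mathrm{B}$ with $e^{p}=q$ if and only if $q$ is nonsingular.
   Context: A bicomplex number is a pair $(a,b)$ of complex numbers. The space of bicomplex numbers is $\mathrm{B}=\mathbb{C}^2$, with componentwise addition and multiplication $(a,b)\odot(c,d)=(ac-bd,\ bc+ad)$. A bicomplex number $(a,b)$ is called singular if $a^2+b^2=0$, and nonsingular otherwise (in particular $0=(0,0)$ is singular). In the definition of $e^p$, the functions $e^a$, $\cos b$, $\sin b$ are the usual complex functions. *)

theory Defs
  imports "HOL-Analysis.Analysis"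
begin

(* Addition is the componentwise (+) that the library provides on product types. *)
type_synonym bicomplex = "complex \<times> complex"

fun bc_mult :: "bicomplex \<Rightarrow> bicomplex \<Rightarrow> bicomplex"  (infixl "\<odot>" 70) where
  "(a, b) \<odot> (c, d) = (a * c - b * d, b * c + a * d)"

fun bc_singular :: "bicomplex \<Rightarrow> bool" where
  "bc_singular (a, b) \<longleftrightarrow> a\<^sup>2 + b\<^sup>2 = 0"

abbreviation bc_nonsingular :: "bicomplex \<Rightarrow> bool" where
  "bc_nonsingular p \<equiv> \<not> bc_singular p"

fun bc_exp :: "bicomplex \<Rightarrow> bicomplex" where
  "bc_exp (a, b) = (exp a * cos b, exp a * sin b)"

lemma bc_exp_add: "bc_exp (p + q) = bc_exp p \<odot> bc_exp q"
  by (cases p; cases q) (simp add: exp_add cos_add sin_add algebra_simps)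

end

(* In the idempotent coordinates c + i d and c - i d the form c^2 + d^2 factors as
   (c + i d) (c - i d), and by Euler's formula the bicomplex exponential of (a, b) has
   coordinates exp (a + i b) and exp (a - i b). So the claim reduces to the fact that the
   complex exponential takes exactly the nonzero values. *)
theory Submission
  imports Defs
begin

lemma bc_singular_iff:
  "bc_singular (c, d) \<longleftrightarrow> c + \<i> * d = 0 \<or> c - \<i> * d = 0"
proof -
  have "c\<^sup>2 + d\<^sup>2 = (c + \<i> * d) * (c - \<i> * d)"
    by (simp add: algebra_simps power2_eq_square)
  then show ?thesis by simp
qed

lemma bc_exp_eq_iff:
  "bc_exp (a, b) = (c, d) \<longleftrightarrow> exp (a + \<i> * b) = c + \<i> * d \<and> exp (a - \<i> * b) = c - \<i> * d"
proof -
  have plus: "exp (a + \<i> * b) = exp a * cos b + \<i> * (exp a * sin b)"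
    by (simp add: exp_add exp_Euler algebra_simps)
  have minus: "exp (a - \<i> * b) = exp a * cos b - \<i> * (exp a * sin b)"
    using exp_add[of a "- (\<i> * b)"] by (simp add: exp_minus_Euler right_diff_distrib mult_ac)
  \<comment> \<open>The idempotent coordinates determine the pair: adding and subtracting the two
    equations recovers \<open>2 * x\<close> and \<open>2 * \<i> * y\<close>.\<close>
  have "x = c \<and> y = d" if "x + \<i> * y = c + \<i> * d" "x - \<i> * y = c - \<i> * d" for x y
  proof -
    have "2 * x = 2 * c" "2 * \<i> * y = 2 * \<i> * d"
      using arg_cong2[OF that, of "(+)"] arg_cong2[OF that, of "(-)"] by simp_all
    then show ?thesis by simp
  qed
  then show ?thesis unfolding plus minus by auto
qed

theorem mainTheorem2:
  fixes q :: bicomplex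
  shows "(\<exists>p :: bicomplex. bc_exp p = q) \<longleftrightarrow> bc_nonsingular q"
proof -
  obtain c d where q: "q = (c, d)" by (cases q)
  show ?thesis
  proof
    assume "\<exists>p. bc_exp p = q"
    then obtain a b where "bc_exp (a, b) = (c, d)" using q by auto
    then show "bc_nonsingular q"
      unfolding q bc_singular_iff bc_exp_eq_iff by (metis exp_not_eq_zero)
  next
    assume "bc_nonsingular q"
    then have nz: "c + \<i> * d \<noteq> 0" "c - \<i> * d \<noteq> 0"
      unfolding q bc_singular_iff by simp_all
    \<comment> \<open>Any logarithms of the two nonzero coordinates of \<open>q\<close> would do.
      Solving \<open>a + \<i> * b = u\<close> and \<open>a - \<i> * b = v\<close> for
      \<open>a\<close> and \<open>b\<close> gives the preimage
      \<open>((u + v) / 2, (u - v) / (2 * \<i>))\<close>.\<close>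
    define u v where "u = Ln (c + \<i> * d)" and "v = Ln (c - \<i> * d)"
    have "(u + v) / 2 + \<i> * ((u - v) / (2 * \<i>)) = u" "(u + v) / 2 - \<i> * ((u - v) / (2 * \<i>)) = v"
      by (simp_all add: field_simps)
    then have "bc_exp ((u + v) / 2, (u - v) / (2 * \<i>)) = q"
      unfolding q bc_exp_eq_iff using nz by (simp add: u_def v_def)
    then show "\<exists>p. bc_exp p = q" by blast
  qed
qed

end
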